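(* Let $(X_1,d_1)$ and $(X_2,d_2)$ be metric spaces such that one of them is a path metric space. Let $d=\max\{d_1,d_2\}$, i.e. $d((x_1,x_2),(y_1,y_2))=\max\{d_1(x_1,y_1),d_2(x_2,y_2)\}$ on $X_1\times X_2$. Then $(X_1\times X_2,d)$ is Gromov hyperbolic if and only if one of the factors $(X_1,d_1)$, $(X_2,d_2)$ is Gromov hyperbolic and the metric of the other one is bounded (in particular, that other one is also Gromov hyperbolic).
   Context: Metric spaces are understood to be nonempty. For a metric space $(D,d)$ and $x,y,z\in D$, the Gromov product is $(x,y)_z=d(x,z)+d(z,y)-d(x,y)$. Put $S_d(p,q,x,w)=\min\{(p,x)_w,(x,q)_w\}-(p,q)_w$. The space $(D,d)$ is Gromov hyperbolic if $\sup_{p,q,x,w\in D}S_d(p,q,x,w)<\infty$. A metric space $(D,d)$ is a path metric space if for any $x,y\in D$ and any $\varepsilon>0$ there exists a rectifiable path joining $x$ and $y$ with length at most $d(x,y)+\varepsilon$. A metric $d$ on $X$ is bounded if $\sup_{x,y\in X}d(x,y)<\infty$. *)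

theory Defs
  imports "HOL-Analysis.Analysis"
begin

text \<open>No factor 1/2, in contrast to the most common normalisation of the Gromov product.\<close>

definition gromov_product :: "('a \<Rightarrow> 'a \<Rightarrow> real) \<Rightarrow> 'a \<Rightarrow> 'a \<Rightarrow> 'a \<Rightarrow> real" where
  "gromov_product d x y z = d x z + d z y - d x y"

definition gromov_defect :: "('a \<Rightarrow> 'a \<Rightarrow> real) \<Rightarrow> 'a \<Rightarrow> 'a \<Rightarrow> 'a \<Rightarrow> 'a \<Rightarrow> real" where
  "gromov_defect d p q x w =
     min (gromov_product d p x w) (gromov_product d x q w) - gromov_product d p q w"

definition gromov_hyperbolic :: "'a set \<Rightarrow> ('a \<Rightarrow> 'a \<Rightarrow> real) \<Rightarrow> bool" where
  "gromov_hyperbolic X d \<longleftrightarrow>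
     bdd_above {gromov_defect d p q x w | p q x w. p \<in> X \<and> q \<in> X \<and> x \<in> X \<and> w \<in> X}"

text \<open>The supremum of the lengths of inscribed polygons over all finite sequences
  \<open>0 \<le> t 0 \<le> \<dots> \<le> t n \<le> 1\<close>. Leaving the end points of the interval out of the sequence
  does not change the supremum.\<close>

definition path_length :: "('a \<Rightarrow> 'a \<Rightarrow> real) \<Rightarrow> (real \<Rightarrow> 'a) \<Rightarrow> ereal" where
  "path_length d g =
     (SUP (n, t) \<in> {(n, t). mono_on {..n::nat} t \<and> t ` {..n} \<subseteq> {0..1}}.
        ereal (\<Sum>i<n. d (g (t i)) (g (t (Suc i)))))"

definition rectifiable :: "('a \<Rightarrow> 'a \<Rightarrow> real) \<Rightarrow> (real \<Rightarrow> 'a) \<Rightarrow> bool" where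
  "rectifiable d g \<longleftrightarrow> path_length d g < \<infinity>"

definition path_metric_space :: "'a set \<Rightarrow> ('a \<Rightarrow> 'a \<Rightarrow> real) \<Rightarrow> bool" where
  "path_metric_space X d \<longleftrightarrow> Metric_space X d \<and>
     (\<forall>x\<in>X. \<forall>y\<in>X. \<forall>\<epsilon>>0. \<exists>g. pathin (Metric_space.mtopology X d) g \<and> g 0 = x \<and> g 1 = y \<and>
        rectifiable d g \<and> path_length d g \<le> ereal (d x y + \<epsilon>))"

definition max_dist ::
  "('a \<Rightarrow> 'a \<Rightarrow> real) \<Rightarrow> ('b \<Rightarrow> 'b \<Rightarrow> real) \<Rightarrow> 'a \<times> 'b \<Rightarrow> 'a \<times> 'b \<Rightarrow> real" where
  "max_dist d1 d2 = (\<lambda>(x1, x2) (y1, y2). max (d1 x1 y1) (d2 x2 y2))"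

lemma Metric_space_max_dist:
  assumes "Metric_space X1 d1" and "Metric_space X2 d2"
  shows "Metric_space (X1 \<times> X2) (max_dist d1 d2)"
proof -
  interpret M1: Metric_space X1 d1 by fact
  interpret M2: Metric_space X2 d2 by fact
  show ?thesis
  proof
    fix p q :: "'a \<times> 'b"
    show "0 \<le> max_dist d1 d2 p q"
      by (auto simp: max_dist_def le_max_iff_disj split: prod.split)
    show "max_dist d1 d2 p q = max_dist d1 d2 q p"
      by (auto simp: max_dist_def M1.commute M2.commute split: prod.split)
  next
    fix p q assume pq: "p \<in> X1 \<times> X2" "q \<in> X1 \<times> X2"
    obtain a b a' b' where eq: "p = (a, b)" "q = (a', b')" by fastforce
    have "max (d1 a a') (d2 b b') = 0 \<longleftrightarrow> d1 a a' = 0 \<and> d2 b b' = 0"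
      using M1.nonneg[of a a'] M2.nonneg[of b b'] by linarith
    then show "max_dist d1 d2 p q = 0 \<longleftrightarrow> p = q"
      using pq by (simp add: eq max_dist_def)
  next
    fix p q r assume "p \<in> X1 \<times> X2" "q \<in> X1 \<times> X2" "r \<in> X1 \<times> X2"
    moreover obtain a b a' b' a'' b'' where "p = (a, b)" "q = (a', b')" "r = (a'', b'')"
      by (metis surj_pair)
    ultimately show "max_dist d1 d2 p r \<le> max_dist d1 d2 p q + max_dist d1 d2 q r"
      using M1.triangle[of a a' a''] M2.triangle[of b b' b''] by (auto simp: max_dist_def)
  qed
qed

lemma (in Metric_space) mbounded_carrier_iff:
  "mbounded M \<longleftrightarrow> bdd_above {d x y | x y. x \<in> M \<and> y \<in> M}"
  unfolding mbounded_alt bdd_above_def by blast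

end

theory Submission
  imports Defs
begin

text \<open>
  Expanding the Gromov products turns the defect into the four-point quantity
  \<open>d p q + d x w - max (d p x + d q w) (d x q + d p w)\<close>. Hence hyperbolicity pulls back along
  maps that distort distances by a bounded amount only
  (\<open>gromov_hyperbolic_almost_isometric\<close>). Bounded spaces (compare \<open>d\<close> with the zero function),
  the factors of a product (slices) and products with a bounded factor (projection to the other
  factor) are instances.

  What remains is that a hyperbolic product has a bounded factor. Suppose that both factors are
  unbounded and that \<open>X1\<close> is a path metric space. Take \<open>a\<close>, \<open>b\<close> in \<open>X2\<close> at a large distance \<open>L\<close>,
  then \<open>u\<close>, \<open>v\<close> in \<open>X1\<close> at distance at least \<open>2 * L\<close>, and on an almost geodesic path between
  them a point \<open>m\<close> with \<open>d1 u m = L\<close>. The points \<open>(u, a)\<close>, \<open>(v, b)\<close>, \<open>(m, a)\<close>, \<open>(m, b)\<close> then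
  have defect about \<open>L\<close>: both sums inside the maximum are about \<open>d1 u v\<close>, whereas the remaining
  one is \<open>d1 u v + L\<close> (\<open>hyperbolic_product_bounded_factor\<close>). Only two points of \<open>X2\<close> occur, which
  is why it suffices that one factor is a path metric space.
\<close>

lemma gromov_defect_four_point:
  assumes "Metric_space X d"
  shows "gromov_defect d p q x w = d p q + d x w - max (d p x + d q w) (d x q + d p w)"
proof -
  interpret Metric_space X d by fact
  show ?thesis
    unfolding gromov_defect_def gromov_product_def
    using commute[of w x] commute[of w q] by linarith
qed

lemma gromov_hyperbolic_iff:
  "gromov_hyperbolic X d \<longleftrightarrow>
     (\<exists>K. \<forall>p\<in>X. \<forall>q\<in>X. \<forall>x\<in>X. \<forall>w\<in>X. gromov_defect d p q x w \<le> K)"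
  unfolding gromov_hyperbolic_def bdd_above_def by blast

text \<open>Each Gromov product is a signed sum of three distances, and the defect is the difference of a
  minimum of Gromov products and a further one, so that it changes by at most \<open>3 * C + 3 * C\<close>.
  The statement is about arbitrary functions so that \<open>d\<close> can also be the zero function.\<close>

lemma gromov_hyperbolic_almost_isometric:
  assumes hyp: "gromov_hyperbolic X d"
    and maps: "f ` Y \<subseteq> X"
    and dist: "\<And>x y. x \<in> Y \<Longrightarrow> y \<in> Y \<Longrightarrow> \<bar>d (f x) (f y) - e x y\<bar> \<le> C"
  shows "gromov_hyperbolic Y e"
proof -
  obtain K where K: "\<And>p q x w. p \<in> X \<Longrightarrow> q \<in> X \<Longrightarrow> x \<in> X \<Longrightarrow> w \<in> X \<Longrightarrow> gromov_defect d p q x w \<le> K"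
    using hyp unfolding gromov_hyperbolic_iff by blast
  have product: "\<bar>gromov_product d (f x) (f y) (f z) - gromov_product e x y z\<bar> \<le> 3 * C"
    if "x \<in> Y" "y \<in> Y" "z \<in> Y" for x y z
    unfolding gromov_product_def
    using dist[of x z] dist[of z y] dist[of x y] that by linarith
  have "gromov_defect e p q x w \<le> K + 6 * C"
    if Y: "p \<in> Y" "q \<in> Y" "x \<in> Y" "w \<in> Y" for p q x w
  proof -
    have "gromov_defect e p q x w \<le> gromov_defect d (f p) (f q) (f x) (f w) + 6 * C"
      unfolding gromov_defect_def
      using product[of p x w] product[of x q w] product[of p q w] Y by linarith
    also have "gromov_defect d (f p) (f q) (f x) (f w) \<le> K"
      using K maps Y by blast
    finally show ?thesis by simp
  qed
  then show ?thesis
    unfolding gromov_hyperbolic_iff by blast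
qed

lemma mbounded_carrierE:
  assumes "Metric_space X d" and "Metric_space.mbounded X d X"
  obtains B where "\<And>x y. x \<in> X \<Longrightarrow> y \<in> X \<Longrightarrow> d x y \<le> B"
  using assms(2) unfolding Metric_space.mbounded_alt[OF assms(1)] by blast

lemma gromov_hyperbolic_if_mbounded:
  assumes "Metric_space X d" and "Metric_space.mbounded X d X"
  shows "gromov_hyperbolic X d"
proof -
  interpret Metric_space X d by fact
  obtain B where "\<And>x y. x \<in> X \<Longrightarrow> y \<in> X \<Longrightarrow> d x y \<le> B"
    by (rule mbounded_carrierE[OF assms]) blast
  moreover have "gromov_hyperbolic X (\<lambda>_ _. 0)"
    by (auto simp: gromov_hyperbolic_iff gromov_defect_def gromov_product_def)
  ultimately show ?thesis
    using gromov_hyperbolic_almost_isometric[of X "\<lambda>_ _. 0" id X d B] nonneg by simp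
qed

lemma gromov_hyperbolic_max_dist_swap:
  assumes "gromov_hyperbolic (X1 \<times> X2) (max_dist d1 d2)"
  shows "gromov_hyperbolic (X2 \<times> X1) (max_dist d2 d1)"
  by (rule gromov_hyperbolic_almost_isometric[OF assms, of prod.swap _ _ 0])
    (auto simp: max_dist_def max.commute)

lemma gromov_hyperbolic_max_dist_if_mbounded:
  assumes "Metric_space X1 d1" and "Metric_space X2 d2"
    and "gromov_hyperbolic X1 d1" and "Metric_space.mbounded X2 d2 X2"
  shows "gromov_hyperbolic (X1 \<times> X2) (max_dist d1 d2)"
proof -
  obtain B where B: "\<And>x y. x \<in> X2 \<Longrightarrow> y \<in> X2 \<Longrightarrow> d2 x y \<le> B"
    by (rule mbounded_carrierE[OF assms(2,4)]) blast
  have "\<bar>d1 (fst p) (fst q) - max_dist d1 d2 p q\<bar> \<le> B"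
    if "p \<in> X1 \<times> X2" "q \<in> X1 \<times> X2" for p q
    using that B[of "snd p" "snd q"]
      Metric_space.nonneg[OF \<open>Metric_space X1 d1\<close>, of "fst p" "fst q"]
      Metric_space.nonneg[OF \<open>Metric_space X2 d2\<close>, of "snd p" "snd q"]
    by (auto simp: max_dist_def)
  then show ?thesis
    by (intro gromov_hyperbolic_almost_isometric[OF assms(3), of fst _ _ B]) auto
qed

lemma gromov_hyperbolic_fst_factor:
  assumes "Metric_space X1 d1" and "Metric_space X2 d2" and "X2 \<noteq> {}"
    and "gromov_hyperbolic (X1 \<times> X2) (max_dist d1 d2)"
  shows "gromov_hyperbolic X1 d1"
proof -
  interpret M1: Metric_space X1 d1 by fact
  interpret M2: Metric_space X2 d2 by fact
  obtain z where "z \<in> X2"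
    using \<open>X2 \<noteq> {}\<close> by blast
  then show ?thesis
    by (intro gromov_hyperbolic_almost_isometric[OF assms(4), of "\<lambda>x. (x, z)" _ _ 0])
      (auto simp: max_dist_def)
qed

text \<open>An almost geodesic path attains, by the intermediate value theorem, every distance from its
  starting point that is at most the distance of its end points.\<close>

lemma path_metric_space_almost_between:
  assumes path: "path_metric_space X d"
    and "u \<in> X" "v \<in> X" and "0 \<le> L" "L \<le> d u v" and "\<epsilon> > 0"
  obtains m where "m \<in> X" "d u m = L" "d u m + d m v \<le> d u v + \<epsilon>"
proof -
  interpret Metric_space X d
    using path by (simp add: path_metric_space_def)
  obtain g where g: "pathin mtopology g" "g 0 = u" "g 1 = v"
    and len: "path_length d g \<le> ereal (d u v + \<epsilon>)"
    using assms unfolding path_metric_space_def by blast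
  have gX: "g t \<in> X" if "t \<in> {0..1}" for t
    using g(1) that unfolding pathin_def continuous_map_def by auto
  have "continuous_map (top_of_set {0..1}) euclidean (\<lambda>t. d u (g t))"
    using continuous_map_mdist[of "top_of_set {0..1}" Self "\<lambda>_. u" g] g(1) \<open>u \<in> X\<close>
    by (simp add: pathin_def mtopology_of_def)
  then have "continuous_on {0..1} (\<lambda>t. d u (g t))"
    by simp
  then obtain s where s: "0 \<le> s" "s \<le> 1" "d u (g s) = L"
    using IVT'[of "\<lambda>t. d u (g t)" 0 L 1] g assms by auto
  \<comment> \<open>The polygon with vertices \<open>u\<close>, \<open>g s\<close>, \<open>v\<close> is inscribed in the path.\<close>
  define t :: "nat \<Rightarrow> real" where "t i = (if i = 0 then 0 else if i = 1 then s else 1)" for i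
  have "mono_on {..2} t" "t ` {..2} \<subseteq> {0..1}"
    using s by (auto simp: t_def mono_on_def)
  then have "ereal (\<Sum>i<2. d (g (t i)) (g (t (Suc i)))) \<le> path_length d g"
    unfolding path_length_def by (intro SUP_upper2[of "(2, t)"]) auto
  then have "d u (g s) + d (g s) v \<le> d u v + \<epsilon>"
    using len g by (force simp: t_def numeral_2_eq_2 dest: order_trans)
  then show ?thesis
    using that gX s by auto
qed

lemma hyperbolic_product_bounded_factor:
  assumes path: "path_metric_space X1 d1" and "Metric_space X2 d2"
    and hyp: "gromov_hyperbolic (X1 \<times> X2) (max_dist d1 d2)"
  shows "Metric_space.mbounded X1 d1 X1 \<or> Metric_space.mbounded X2 d2 X2"
proof (rule ccontr)
  assume unbounded: "\<not> ?thesis"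
  have "Metric_space X1 d1"
    using path by (simp add: path_metric_space_def)
  interpret M1: Metric_space X1 d1 by fact
  interpret M2: Metric_space X2 d2 by fact
  obtain K where K: "\<And>p q x w. p \<in> X1 \<times> X2 \<Longrightarrow> q \<in> X1 \<times> X2 \<Longrightarrow> x \<in> X1 \<times> X2 \<Longrightarrow> w \<in> X1 \<times> X2
      \<Longrightarrow> gromov_defect (max_dist d1 d2) p q x w \<le> K"
    using hyp unfolding gromov_hyperbolic_iff by blast
  \<comment> \<open>The defect below is at least \<open>d2 a b - 1\<close>; the 1 is the excess that is allowed for the path
    from \<open>u\<close> to \<open>v\<close>.\<close>
  obtain a b where ab: "a \<in> X2" "b \<in> X2" "d2 a b > K + 1"
    using unbounded M2.mbounded_alt by (metis not_le order_refl)
  define L where "L = d2 a b"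
  obtain u v where uv: "u \<in> X1" "v \<in> X1" "d1 u v > 2 * L"
    using unbounded M1.mbounded_alt by (metis not_le order_refl)
  have "0 \<le> L"
    by (simp add: L_def)
  with uv have "L \<le> d1 u v"
    by linarith
  then obtain m where m: "m \<in> X1" "d1 u m = L" "d1 u m + d1 m v \<le> d1 u v + 1"
    using path_metric_space_almost_between[OF path uv(1,2) \<open>0 \<le> L\<close>, of 1] by auto
  have dists:
    "max_dist d1 d2 (u, a) (v, b) = d1 u v"
    "max_dist d1 d2 (m, a) (m, b) = L"
    "max_dist d1 d2 (u, a) (m, a) = L"
    "max_dist d1 d2 (v, b) (m, b) = d1 m v"
    "max_dist d1 d2 (m, a) (v, b) = max (d1 m v) L"
    "max_dist d1 d2 (u, a) (m, b) = L"
    using uv m ab \<open>0 \<le> L\<close> \<open>L \<le> d1 u v\<close> M1.commute[of m v]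
    by (simp_all add: max_dist_def flip: L_def)
  have "K < L - 1"
    using ab by (simp add: L_def)
  also have "L - 1 \<le> d1 u v + L - max (L + d1 m v) (max (d1 m v) L + L)"
    using m uv \<open>0 \<le> L\<close> by linarith
  also have "\<dots> = gromov_defect (max_dist d1 d2) (u, a) (v, b) (m, a) (m, b)"
    unfolding gromov_defect_four_point[OF Metric_space_max_dist[OF \<open>Metric_space X1 d1\<close>
      \<open>Metric_space X2 d2\<close>]] dists ..
  also have "\<dots> \<le> K"
    using K ab uv m by blast
  finally show False
    by simp
qed

theorem proposition2:
  fixes X1 :: "'a set" and d1 :: "'a \<Rightarrow> 'a \<Rightarrow> real"
    and X2 :: "'b set" and d2 :: "'b \<Rightarrow> 'b \<Rightarrow> real"
  assumes "Metric_space X1 d1" and "X1 \<noteq> {}"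
    and "Metric_space X2 d2" and "X2 \<noteq> {}"
    and "path_metric_space X1 d1 \<or> path_metric_space X2 d2"
  shows "(gromov_hyperbolic (X1 \<times> X2) (max_dist d1 d2) \<longleftrightarrow>
            (gromov_hyperbolic X1 d1 \<and> Metric_space.mbounded X2 d2 X2) \<or>
            (gromov_hyperbolic X2 d2 \<and> Metric_space.mbounded X1 d1 X1))
       \<and> (Metric_space.mbounded X1 d1 X1 \<longrightarrow> gromov_hyperbolic X1 d1)
       \<and> (Metric_space.mbounded X2 d2 X2 \<longrightarrow> gromov_hyperbolic X2 d2)"
proof -
  have factors: "gromov_hyperbolic X1 d1" "gromov_hyperbolic X2 d2"
    and bounded: "Metric_space.mbounded X1 d1 X1 \<or> Metric_space.mbounded X2 d2 X2"
    if hyp: "gromov_hyperbolic (X1 \<times> X2) (max_dist d1 d2)"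
  proof -
    note swapped = gromov_hyperbolic_max_dist_swap[OF hyp]
    show "gromov_hyperbolic X1 d1" "gromov_hyperbolic X2 d2"
      using gromov_hyperbolic_fst_factor hyp swapped assms(1-4) by blast+
    show "Metric_space.mbounded X1 d1 X1 \<or> Metric_space.mbounded X2 d2 X2"
      using assms(5) hyperbolic_product_bounded_factor[OF _ assms(3) hyp]
        hyperbolic_product_bounded_factor[OF _ assms(1) swapped] by blast
  qed
  have converse: "gromov_hyperbolic (X1 \<times> X2) (max_dist d1 d2)"
    if "(gromov_hyperbolic X1 d1 \<and> Metric_space.mbounded X2 d2 X2) \<or>
        (gromov_hyperbolic X2 d2 \<and> Metric_space.mbounded X1 d1 X1)"
    using that assms(1,3) gromov_hyperbolic_max_dist_if_mbounded gromov_hyperbolic_max_dist_swap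
    by metis
  show ?thesis
    using factors bounded converse gromov_hyperbolic_if_mbounded[OF assms(1)]
      gromov_hyperbolic_if_mbounded[OF assms(3)] by argo
qed

end
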